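(* Let $m,n\in\mathbb{N}$, $E\subseteq\mathbf T_{m,n}$, and $0\le k\le\min(n-1,m)$. Suppose at least one of the following holds: (a) there exist two different $k$-subspheres $\Phi_1,\Phi_2$ of $\mathbb{S}^{n-1}$ and an $(m-k)$-dimensional linear subspace $H$ of $\mathbb{R}^m$ with $H\times(\Phi_1\cup\Phi_2)\subseteq\overline E$; (b) there exist a $k$-subsphere $\Phi$ of $\mathbb{S}^{n-1}$ and two different $(m-k)$-dimensional linear subspaces $H_1,H_2$ of $\mathbb{R}^m$ with $(H_1\cup H_2)\times\Phi\subseteq\overline E$; (c) there exist a $k$-subsphere $\Phi$ of $\mathbb{S}^{n-1}$ and an $(m-k)$-dimensional linear subspace $H$ of $\mathbb{R}^m$ with $H\times\Phi\subseteq\overline{E\smallsetminus(H\times\Phi)}$. Then the collection $\mathcal L_E$ contains a totally dense subcollection.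
   Context: $\mathbf T_{m,n}=\mathbb{R}^m\times\mathbb{S}^{n-1}$ with the product topology (Euclidean metric on $\mathbb{R}^m$, metric on $\mathbb{S}^{n-1}$ induced from $\mathbb{R}^n$); closures are taken in $\mathbf T_{m,n}$. $M_{m,n}$ is the space of real $m\times n$ matrices. For $(\mathbf p,\theta)\in\mathbf T_{m,n}$, $L_{\mathbf p,\theta}=\{A\in M_{m,n}:A\theta=\mathbf p\}$, and $\mathcal L_E=\{L_{\mathbf p,\theta}:(\mathbf p,\theta)\in E\}$. A $k$-subsphere of $\mathbb{S}^{n-1}$ is the intersection of $\mathbb{S}^{n-1}$ with a $(k+1)$-dimensional linear subspace of $\mathbb{R}^n$. A collection $\mathcal L$ of proper closed subsets of $X=M_{m,n}$ is dense if its union is dense; totally dense if dense and for every open $W$ and $L\in\mathcal L$ with $L\cap W\neq\varnothing$, the closure of $\bigcup\{L'\in\mathcal L:L'\cap L\cap W\ne\varnothing\}$ has nonempty interior. *)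

theory Defs
  imports "HOL-Analysis.Analysis"
begin

definition T_space :: "((real ^ 'm) \<times> (real ^ 'n)) set" where
  "T_space = UNIV \<times> sphere 0 1"

abbreviation T_closure ::
    "((real ^ 'm) \<times> (real ^ 'n)) set \<Rightarrow> ((real ^ 'm) \<times> (real ^ 'n)) set" where
  "T_closure S \<equiv> (top_of_set T_space) closure_of S"

definition subsphere :: "nat \<Rightarrow> (real ^ 'n) set \<Rightarrow> bool" where
  "subsphere k \<Phi> \<longleftrightarrow> (\<exists>V. subspace V \<and> dim V = k + 1 \<and> \<Phi> = sphere 0 1 \<inter> V)"

definition L_set :: "real ^ 'm \<Rightarrow> real ^ 'n \<Rightarrow> (real ^ 'n ^ 'm) set" where
  "L_set p \<theta> = {A. A *v \<theta> = p}"

definition L_coll :: "((real ^ 'm) \<times> (real ^ 'n)) set \<Rightarrow> (real ^ 'n ^ 'm) set set" where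
  "L_coll E = {L_set p \<theta> | p \<theta>. (p, \<theta>) \<in> E}"

definition dense_coll :: "'a::topological_space set set \<Rightarrow> bool" where
  "dense_coll \<L> \<longleftrightarrow> closure (\<Union>\<L>) = UNIV"

text \<open>Total density is a notion for collections of proper closed subsets of the ambient space;
  this requirement is made part of the predicate.\<close>

definition totally_dense :: "'a::topological_space set set \<Rightarrow> bool" where
  "totally_dense \<L> \<longleftrightarrow>
     (\<forall>L\<in>\<L>. closed L \<and> L \<noteq> UNIV) \<and>
     dense_coll \<L> \<and>
     (\<forall>W L. open W \<longrightarrow> L \<in> \<L> \<longrightarrow> L \<inter> W \<noteq> {} \<longrightarrow>
        interior (closure (\<Union>{L' \<in> \<L>. L' \<inter> L \<inter> W \<noteq> {}})) \<noteq> {})"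

end

theory Submission
  imports Defs
begin

text \<open>If \<open>\<Phi>\<close> is a \<open>k\<close>-subsphere spanning \<open>V\<close> and \<open>H\<close> has dimension \<open>m - k\<close>, a dimension count shows
  that every matrix \<open>A\<close> maps some \<open>v \<in> \<Phi>\<close> into \<open>H\<close>, so the sets \<open>L\<close> with parameters in \<open>H \<times> \<Phi>\<close> cover
  the whole matrix space. Let \<open>A0\<close> lie on the \<open>L\<close> with parameter \<open>(p, \<theta>) \<notin> H \<times> \<Phi>\<close>. Then any such \<open>v\<close> for
  \<open>A0\<close> is linearly independent of \<open>\<theta>\<close>, and by compactness this persists, uniformly, for all \<open>A\<close> close to
  \<open>A0\<close>. Hence \<open>A\<close> can be perturbed slightly so as to meet both the constraint \<open>(p, \<theta>)\<close> and any
  constraint \<open>(q, \<eta>) \<in> E\<close> close to \<open>(A v, v)\<close>, and such \<open>L\<close>'s accumulate at \<open>A\<close>. In each of the three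
  cases one gets two products \<open>H1 \<times> \<Phi>1\<close>, \<open>H2 \<times> \<Phi>2\<close> (equal in case (c)) which still lie in the closure
  of \<open>E\<close> after deleting their intersection from \<open>E\<close>; each remaining parameter then misses one of them.\<close>

section \<open>Rank-one corrections of matrices\<close>

definition outer_prod :: "real ^ 'm \<Rightarrow> real ^ 'n \<Rightarrow> real ^ 'n ^ 'm" where
  "outer_prod p a = (\<chi> i j. p $ i * a $ j)"

lemma outer_prod_mult_vec: "outer_prod p a *v x = (a \<bullet> x) *\<^sub>R p"
  by (simp add: vec_eq_iff outer_prod_def matrix_vector_mult_def inner_vec_def sum_distrib_left
      sum_distrib_right mult_ac)

lemma continuous_on_outer_prod [continuous_intros]:
  assumes "continuous_on S f" "continuous_on S g"
  shows "continuous_on S (\<lambda>x. outer_prod (f x) (g x))"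
  unfolding outer_prod_def using assms by (intro continuous_intros)

lemma continuous_on_matrix_vector_mult [continuous_intros]:
  fixes f :: "'a::topological_space \<Rightarrow> real ^ 'n ^ 'm"
  assumes "continuous_on S f" "continuous_on S g"
  shows "continuous_on S (\<lambda>x. f x *v g x)"
  unfolding matrix_vector_mult_def using assms by (intro continuous_intros)

text \<open>The dual basis of \<open>\<theta>\<close>, \<open>\<eta>\<close> in their span is used to force the values at \<open>\<theta>\<close> and \<open>\<eta>\<close>.\<close>

definition adjust :: "real ^ 'm \<Rightarrow> real ^ 'n \<Rightarrow> real ^ 'n ^ 'm \<Rightarrow> real ^ 'm \<Rightarrow> real ^ 'n \<Rightarrow> real ^ 'n ^ 'm"
  where "adjust p \<theta> A q \<eta> = A
    + outer_prod (p - A *v \<theta>) ((1 / (1 - (\<theta> \<bullet> \<eta>)\<^sup>2)) *\<^sub>R (\<theta> - (\<theta> \<bullet> \<eta>) *\<^sub>R \<eta>))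
    + outer_prod (q - A *v \<eta>) ((1 / (1 - (\<theta> \<bullet> \<eta>)\<^sup>2)) *\<^sub>R (\<eta> - (\<theta> \<bullet> \<eta>) *\<^sub>R \<theta>))"

lemma adjust_mult_vec:
  assumes "norm \<theta> = 1" "norm \<eta> = 1" "(\<theta> \<bullet> \<eta>)\<^sup>2 \<noteq> 1"
  shows "adjust p \<theta> A q \<eta> *v \<theta> = p" "adjust p \<theta> A q \<eta> *v \<eta> = q"
proof -
  have "\<theta> \<bullet> \<theta> = 1" "\<eta> \<bullet> \<eta> = 1" using assms by (simp_all add: dot_square_norm)
  then show "adjust p \<theta> A q \<eta> *v \<theta> = p" "adjust p \<theta> A q \<eta> *v \<eta> = q"
    using assms(3)
    by (simp_all add: adjust_def matrix_vector_mult_add_rdistrib outer_prod_mult_vec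
        inner_diff_left inner_commute[of \<eta> \<theta>] power2_eq_square)
qed

lemma adjust_self: "A *v \<theta> = p \<Longrightarrow> adjust p \<theta> A (A *v \<eta>) \<eta> = A"
  by (simp add: adjust_def outer_prod_def vec_eq_iff)

text \<open>For unit vectors the inequality says that \<open>\<theta>\<close> and
  \<open>\<eta>\<close> are linearly independent; it also keeps the denominators nonzero, hence
  \<open>adjust\<close> continuous. Openness is joint in matrix and parameter, as the compactness
  argument requires.\<close>

lemma open_adjust_vimage:
  fixes W :: "(real ^ 'n ^ 'm) set"
  assumes "open W"
  shows "open {(A, q, \<eta>). (\<theta> \<bullet> \<eta>)\<^sup>2 \<noteq> 1 \<and> adjust p \<theta> A q \<eta> \<in> W}"
proof -
  define U :: "((real ^ 'n ^ 'm) \<times> (real ^ 'm) \<times> (real ^ 'n)) set"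
    where "U = {x. (\<theta> \<bullet> snd (snd x))\<^sup>2 \<noteq> 1}"
  have "open U"
    unfolding U_def by (intro open_Collect_neq continuous_intros)
  moreover have "continuous_on U (\<lambda>x. adjust p \<theta> (fst x) (fst (snd x)) (snd (snd x)))"
    unfolding adjust_def by (intro continuous_intros) (auto simp: U_def)
  ultimately have "open (U \<inter> (\<lambda>x. adjust p \<theta> (fst x) (fst (snd x)) (snd (snd x))) -` W)"
    using assms by (intro continuous_open_preimage)
  also have "U \<inter> (\<lambda>x. adjust p \<theta> (fst x) (fst (snd x)) (snd (snd x))) -` W
      = {(A, q, \<eta>). (\<theta> \<bullet> \<eta>)\<^sup>2 \<noteq> 1 \<and> adjust p \<theta> A q \<eta> \<in> W}"
    by (auto simp: U_def)
  finally show ?thesis .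
qed

section \<open>Covering and approximating matrices by the sets \<open>L_set q \<eta>\<close>\<close>

text \<open>Otherwise \<open>A\<close> is injective on \<open>V\<close> and its image of
  \<open>V\<close> meets \<open>H\<close> only in 0, so both fit independently into a space of
  dimension \<open>CARD('m)\<close>, against the dimension bound.\<close>

lemma exists_unit_vector_into_subspace:
  fixes A :: "real ^ 'n ^ 'm"
  assumes "subspace V" "subspace H" "dim V + dim H > CARD('m)"
  obtains v where "v \<in> sphere 0 1 \<inter> V" "A *v v \<in> H"
proof -
  have "\<exists>x\<in>V. x \<noteq> 0 \<and> A *v x \<in> H"
  proof (rule ccontr)
    assume none: "\<not> ?thesis"
    let ?f = "\<lambda>x. A *v x"
    have lin: "linear ?f" by simp
    have "inj_on ?f V"
    proof (rule inj_onI)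
      fix x y assume "x \<in> V" "y \<in> V" "A *v x = A *v y"
      then have "x - y \<in> V" "A *v (x - y) \<in> H"
        using assms by (auto simp: subspace_diff matrix_vector_mult_diff_distrib subspace_0)
      with none show "x = y" by auto
    qed
    then have "dim (?f ` V) = dim V"
      by (metis lin assms(1) dim_image_eq span_eq_iff)
    moreover have "?f ` V \<inter> H \<subseteq> {0}" using none by (auto simp: matrix_vector_mult_0_right)
    then have "dim (?f ` V \<inter> H) = 0" by simp
    moreover have "dim {x + y |x y. x \<in> ?f ` V \<and> y \<in> H} + dim (?f ` V \<inter> H)
        = dim (?f ` V) + dim H"
      using assms lin by (intro dim_sums_Int linear_subspace_image)
    moreover have "dim {x + y |x y. x \<in> ?f ` V \<and> y \<in> H} \<le> CARD('m)"
      by (rule dim_subset_UNIV_cart)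
    ultimately show False using assms(3) by linarith
  qed
  then obtain x where "x \<in> V" "x \<noteq> 0" "A *v x \<in> H" by blast
  then have "sgn x \<in> sphere 0 1 \<inter> V" "A *v sgn x \<in> H"
    using assms by (auto simp: norm_sgn sgn_div_norm subspace_scale matrix_vector_mult_scaleR)
  then show thesis by (rule that)
qed

lemma closed_L_set: "closed (L_set p \<theta>)"
  unfolding L_set_def by (intro closed_Collect_eq continuous_intros)

lemma L_set_neq_UNIV:
  fixes p :: "real ^ 'm"
  assumes "\<theta> \<noteq> 0"
  shows "L_set p \<theta> \<noteq> UNIV"
proof
  assume U: "L_set p \<theta> = UNIV"
  \<comment> \<open>The left side is a nonzero multiple of \<open>q\<close>, so it cannot be the
    same for \<open>q = 0\<close> and \<open>q = 1\<close>.\<close>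
  have "outer_prod q \<theta> *v \<theta> = p" for q :: "real ^ 'm"
    using U unfolding L_set_def by blast
  from this[of 0] this[of 1] show False
    using assms by (simp add: outer_prod_mult_vec)
qed

text \<open>A rank-one correction moves \<open>A\<close> into \<open>L_set q \<eta>\<close>. It
  depends continuously on \<open>(q, \<eta>)\<close> and vanishes at
  \<open>(A *v v, v)\<close>.\<close>

lemma in_closure_Union_L_coll:
  fixes A :: "real ^ 'n ^ 'm"
  assumes F: "F \<subseteq> T_space" and "(A *v v, v) \<in> closure F"
  shows "A \<in> closure (\<Union>(L_coll F))"
proof -
  let ?g = "\<lambda>x. A + outer_prod (fst x - A *v snd x) (snd x)"
  have "continuous_on (closure F) ?g" by (intro continuous_intros)
  then have "?g ` closure F \<subseteq> closure (\<Union>(L_coll F))"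
  proof (rule image_closure_subset)
    show "?g ` F \<subseteq> closure (\<Union>(L_coll F))"
    proof clarsimp
      fix q \<eta> assume "(q, \<eta>) \<in> F"
      then have "\<eta> \<bullet> \<eta> = 1" using F by (auto simp: T_space_def dot_square_norm)
      then have "A + outer_prod (q - A *v \<eta>) \<eta> \<in> L_set q \<eta>"
        by (simp add: L_set_def matrix_vector_mult_add_rdistrib outer_prod_mult_vec)
      then show "A + outer_prod (q - A *v \<eta>) \<eta> \<in> closure (\<Union>(L_coll F))"
        using \<open>(q, \<eta>) \<in> F\<close> by (intro closure_subset[THEN subsetD]) (auto simp: L_coll_def)
    qed
  qed simp
  moreover have "?g (A *v v, v) = A" by (simp add: outer_prod_def vec_eq_iff)
  ultimately show ?thesis using assms(2) by (metis (no_types, lifting) image_subset_iff)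
qed

section \<open>Total density from two products of subspaces and subspheres\<close>

lemma interior_closure_meeting_L_sets:
  fixes E :: "((real ^ 'm) \<times> (real ^ 'n)) set"
  assumes E: "E \<subseteq> T_space" and V: "subspace V" and H: "subspace H"
    and dim: "dim V + dim H > CARD('m)"
    and clo: "H \<times> (sphere 0 1 \<inter> V) \<subseteq> closure E"
    and \<theta>: "norm \<theta> = 1" and out: "(p, \<theta>) \<notin> H \<times> V"
    and W: "open W" and meet: "L_set p \<theta> \<inter> W \<noteq> {}"
  shows "interior (closure (\<Union>{L' \<in> L_coll E. L' \<inter> L_set p \<theta> \<inter> W \<noteq> {}})) \<noteq> {}"
proof -
  obtain A0 where A0: "A0 *v \<theta> = p" "A0 \<in> W" using meet by (auto simp: L_set_def)
  \<comment> \<open>Triples for which a matrix in \<open>W\<close> near or equal to \<open>A\<close>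
    can be prescribed at both \<open>\<theta>\<close> and \<open>\<eta>\<close> by
    \<open>adjust\<close>.\<close>
  define G where "G = {(A, q, \<eta>). (\<theta> \<bullet> \<eta>)\<^sup>2 \<noteq> 1 \<and> adjust p \<theta> A q \<eta> \<in> W}"
  have "open G" unfolding G_def by (rule open_adjust_vimage[OF W])
  define Z where "Z = {x :: (real ^ 'n) \<times> (real ^ 'n ^ 'm). snd x *v fst x \<in> H}
    \<inter> - ((\<lambda>x. (snd x, snd x *v fst x, fst x)) -` G)"
  have "closed Z"
    unfolding Z_def
    by (intro closed_Int closed_Compl open_vimage \<open>open G\<close>
        closed_vimage[OF closed_subspace[OF H], unfolded vimage_def] continuous_intros)
  \<comment> \<open>Matrices without a bad unit vector in \<open>V\<close>. The complement is the
    projection of a closed set along a compact factor, hence closed.\<close>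
  define N where "N = - {A. \<exists>v. v \<in> sphere 0 1 \<inter> V \<and> (v, A) \<in> Z}"
  have "compact (sphere 0 1 \<inter> V)"
    using V by (simp add: closed_subspace compact_Int_closed)
  then have "open N"
    unfolding N_def using \<open>closed Z\<close> by (intro open_Compl closed_compact_projection)
  have "A0 \<in> N"
  proof -
    have "(A0, A0 *v v, v) \<in> G" if v: "v \<in> sphere 0 1 \<inter> V" "A0 *v v \<in> H" for v
    proof -
      have "(\<theta> \<bullet> v)\<^sup>2 \<noteq> 1"
      proof
        assume "(\<theta> \<bullet> v)\<^sup>2 = 1"
        \<comment> \<open>Equality in Cauchy-Schwarz forces \<open>\<theta>\<close> to be
          \<open>v\<close> or \<open>- v\<close>, which would put \<open>(p, \<theta>)\<close> into
          \<open>H \<times> V\<close>.\<close>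
        then have "\<bar>\<theta> \<bullet> v\<bar> = norm \<theta> * norm v"
          using \<theta> v by (auto simp: power2_eq_1_iff)
        then have "\<theta> = v \<or> \<theta> = - v"
          using \<theta> v unfolding norm_cauchy_schwarz_abs_eq by auto
        then have "\<theta> \<in> V" "A0 *v \<theta> \<in> H"
          using v V H by (auto simp: subspace_neg linear_neg[OF matrix_vector_mul_linear])
        then show False using out A0 by auto
      qed
      then show ?thesis using A0 by (simp add: G_def adjust_self)
    qed
    then show ?thesis by (auto simp: N_def Z_def)
  qed
  have "N \<subseteq> closure (\<Union>{L' \<in> L_coll E. L' \<inter> L_set p \<theta> \<inter> W \<noteq> {}})"
  proof
    fix A assume "A \<in> N"
    obtain v where v: "v \<in> sphere 0 1 \<inter> V" "A *v v \<in> H"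
      using exists_unit_vector_into_subspace[OF V H dim] .
    \<comment> \<open>The slice of \<open>G\<close> at \<open>A\<close> is a neighbourhood of
      \<open>(A *v v, v)\<close>, so restricting \<open>E\<close> to it keeps that point in the
      closure.\<close>
    define U where "U = (\<lambda>x. (A, x)) -` G"
    have "open U" unfolding U_def by (intro open_vimage \<open>open G\<close> continuous_intros)
    have "(A *v v, v) \<in> U" using \<open>A \<in> N\<close> v by (auto simp: N_def Z_def U_def)
    moreover have "(A *v v, v) \<in> closure E" using clo v by blast
    ultimately have "(A *v v, v) \<in> closure (U \<inter> E)"
      using open_Int_closure_subset[OF \<open>open U\<close>] by blast
    moreover have "U \<inter> E \<subseteq> T_space" using E by blast
    ultimately have "A \<in> closure (\<Union>(L_coll (U \<inter> E)))"
      by (intro in_closure_Union_L_coll)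
    moreover have "L_coll (U \<inter> E) \<subseteq> {L' \<in> L_coll E. L' \<inter> L_set p \<theta> \<inter> W \<noteq> {}}"
    proof
      fix L' assume "L' \<in> L_coll (U \<inter> E)"
      then obtain q \<eta> where L': "L' = L_set q \<eta>" "(q, \<eta>) \<in> U" "(q, \<eta>) \<in> E"
        by (auto simp: L_coll_def)
      have "norm \<eta> = 1" using L' E by (auto simp: T_space_def)
      \<comment> \<open>The adjusted matrix witnesses that \<open>L'\<close> meets
        \<open>L_set p \<theta>\<close> inside \<open>W\<close>; it may differ from the matrices of
        \<open>L'\<close> that accumulate at \<open>A\<close>.\<close>
      then have "adjust p \<theta> A q \<eta> \<in> L' \<inter> L_set p \<theta> \<inter> W"
        using L' \<theta> by (auto simp: U_def G_def L_set_def adjust_mult_vec)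
      then show "L' \<in> {L' \<in> L_coll E. L' \<inter> L_set p \<theta> \<inter> W \<noteq> {}}"
        using L' by (auto simp: L_coll_def)
    qed
    ultimately show "A \<in> closure (\<Union>{L' \<in> L_coll E. L' \<inter> L_set p \<theta> \<inter> W \<noteq> {}})"
      by (meson Union_mono closure_mono subsetD)
  qed
  then show ?thesis
    using \<open>open N\<close> \<open>A0 \<in> N\<close> interior_maximal by blast
qed

text \<open>By \<open>disj\<close> each parameter of \<open>E\<close> misses one of the two
  products, and that product supplies the interior. The products may coincide. Density comes from
  the first product alone.\<close>

lemma totally_dense_L_coll:
  fixes E :: "((real ^ 'm) \<times> (real ^ 'n)) set"
  assumes E: "E \<subseteq> T_space"
    and V: "subspace V1" "subspace V2" and H: "subspace H1" "subspace H2"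
    and dim: "dim V1 + dim H1 > CARD('m)" "dim V2 + dim H2 > CARD('m)"
    and clo: "H1 \<times> (sphere 0 1 \<inter> V1) \<subseteq> closure E" "H2 \<times> (sphere 0 1 \<inter> V2) \<subseteq> closure E"
    and disj: "E \<inter> (H1 \<times> V1) \<inter> (H2 \<times> V2) = {}"
  shows "totally_dense (L_coll E)"
  unfolding totally_dense_def dense_coll_def
proof (intro conjI ballI allI impI)
  fix L assume "L \<in> L_coll E"
  then obtain p \<theta> where "L = L_set p \<theta>" "norm \<theta> = 1"
    using E by (auto simp: L_coll_def T_space_def)
  then show "closed L" "L \<noteq> UNIV"
    using closed_L_set[of p \<theta>] L_set_neq_UNIV[of \<theta> p] norm_zero by force+
next
  show "closure (\<Union>(L_coll E)) = UNIV"
  proof (rule UNIV_eq_I[symmetric])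
    fix A :: "real ^ 'n ^ 'm"
    obtain v where "v \<in> sphere 0 1 \<inter> V1" "A *v v \<in> H1"
      using exists_unit_vector_into_subspace[OF V(1) H(1) dim(1)] .
    then show "A \<in> closure (\<Union>(L_coll E))"
      using clo(1) by (intro in_closure_Union_L_coll[OF E]) blast
  qed
next
  fix W L assume W: "open W" "L \<in> L_coll E" "L \<inter> W \<noteq> {}"
  then obtain p \<theta> where L: "L = L_set p \<theta>" "(p, \<theta>) \<in> E" by (auto simp: L_coll_def)
  then have \<theta>: "norm \<theta> = 1" using E by (auto simp: T_space_def)
  from L disj consider "(p, \<theta>) \<notin> H1 \<times> V1" | "(p, \<theta>) \<notin> H2 \<times> V2" by blast
  then show "interior (closure (\<Union>{L' \<in> L_coll E. L' \<inter> L \<inter> W \<noteq> {}})) \<noteq> {}"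
  proof cases
    case 1
    then show ?thesis
      using interior_closure_meeting_L_sets[OF E V(1) H(1) dim(1) clo(1) \<theta>] W L by simp
  next
    case 2
    then show ?thesis
      using interior_closure_meeting_L_sets[OF E V(2) H(2) dim(2) clo(2) \<theta>] W L by simp
  qed
qed

section \<open>Deleting closed sets without losing closure points\<close>

text \<open>A point of \<open>S\<close> leaves \<open>S\<close> when moved by any nonzero multiple
  of a vector \<open>u\<close> in \<open>V - S\<close>; let the multiples tend to 0.\<close>

lemma subspace_subset_closure_Diff:
  fixes V :: "'a::real_normed_vector set"
  assumes "subspace V" "subspace S" "\<not> V \<subseteq> S"
  shows "V \<subseteq> closure (V - S)"
proof
  fix x assume x: "x \<in> V"
  show "x \<in> closure (V - S)"
  proof (cases "x \<in> S")
    case False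
    with x show ?thesis by (intro closure_subset[THEN subsetD]) auto
  next
    case True
    obtain u where u: "u \<in> V" "u \<notin> S" using assms by blast
    have "x + inverse (real (Suc i)) *\<^sub>R u \<in> V - S" for i
    proof -
      have "inverse (real (Suc i)) *\<^sub>R u \<in> S" if "x + inverse (real (Suc i)) *\<^sub>R u \<in> S"
        using subspace_diff[OF assms(2) that True] by simp
      then have "u \<in> S" if "x + inverse (real (Suc i)) *\<^sub>R u \<in> S"
        using subspace_scale[OF assms(2), of "inverse (real (Suc i)) *\<^sub>R u" "real (Suc i)"] that
        by (simp del: of_nat_Suc)
      then show ?thesis using u x assms by (auto simp: subspace_add subspace_scale)
    qed
    moreover have "(\<lambda>i. x + inverse (real (Suc i)) *\<^sub>R u) \<longlonglongrightarrow> x + 0 *\<^sub>R u"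
      by (intro tendsto_intros LIMSEQ_inverse_real_of_nat)
    ultimately show ?thesis
      unfolding closure_sequential
      by (intro exI[of _ "\<lambda>i. x + inverse (real (Suc i)) *\<^sub>R u"]) (simp del: of_nat_Suc)
  qed
qed

text \<open>Approximate within \<open>V - S\<close> and normalise: scaling by a nonzero factor
  cannot enter \<open>S\<close>, and \<open>sgn\<close> is continuous away from 0.\<close>

lemma sphere_Int_subset_closure_Diff:
  fixes V :: "'a::real_normed_vector set"
  assumes V: "subspace V" and S: "subspace S" and "\<not> V \<subseteq> S"
  shows "sphere 0 1 \<inter> V \<subseteq> closure (sphere 0 1 \<inter> V - S)"
proof
  fix x assume x: "x \<in> sphere 0 1 \<inter> V"
  then have "x \<in> closure (V - S)" using subspace_subset_closure_Diff[OF assms] by blast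
  then obtain y where y: "\<And>i. y i \<in> V - S" "y \<longlonglongrightarrow> x"
    unfolding closure_sequential by blast
  have "sgn (y i) \<in> sphere 0 1 \<inter> V - S" for i
  proof -
    have "y i \<noteq> 0" using y(1)[of i] subspace_0[OF S] by auto
    have "y i \<in> S" if "sgn (y i) \<in> S"
      using subspace_scale[OF S that, of "norm (y i)"] \<open>y i \<noteq> 0\<close> by (simp add: sgn_div_norm)
    then show ?thesis
      using y(1)[of i] \<open>y i \<noteq> 0\<close> V by (auto simp: norm_sgn sgn_div_norm subspace_scale)
  qed
  moreover have "(\<lambda>i. sgn (y i)) \<longlonglongrightarrow> sgn x"
    using x y(2) by (intro tendsto_sgn) auto
  moreover have "sgn x = x" using x by (simp add: sgn_div_norm)
  ultimately show "x \<in> closure (sphere 0 1 \<inter> V - S)"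
    unfolding closure_sequential by metis
qed

text \<open>Near a point of \<open>C - D\<close> the closed set \<open>D\<close> is absent, so only
  \<open>E - D\<close> accumulates there; the rest of \<open>C\<close> consists of limits of such
  points.\<close>

lemma subset_closure_Diff_closed:
  assumes "C \<subseteq> closure (C - D)" "C \<subseteq> closure E" "closed D"
  shows "C \<subseteq> closure (E - D)"
proof -
  have "C - D \<subseteq> closure (E - D)"
    using assms open_Int_closure_subset[of "- D" E] by (auto simp: Diff_eq Int_commute)
  then show ?thesis
    using assms(1) closure_minimal closed_closure by blast
qed

lemma T_closure_subset_closure: "T_closure S \<subseteq> closure S"
  by (auto simp: closure_of_subtopology intro: closure_mono[THEN subsetD])

text \<open>Deleting only \<open>C \<inter> D\<close> is symmetric in \<open>C\<close> and
  \<open>D\<close>, so a single reduced parameter set serves both products.\<close>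

lemma subset_closure_Diff_Int:
  assumes "C \<subseteq> closure (C - D)" "C \<subseteq> closure E" "closed D"
  shows "C \<subseteq> closure (E - C \<inter> D)"
  using subset_closure_Diff_closed[OF assms] closure_mono[of "E - D" "E - C \<inter> D"] by blast

lemma closed_Times_sphere_Int:
  fixes V :: "'a::euclidean_space set" and H :: "'b::euclidean_space set"
  shows "subspace V \<Longrightarrow> subspace H \<Longrightarrow> closed (H \<times> (sphere 0 1 \<inter> V))"
  by (intro closed_Times closed_Int closed_subspace closed_sphere)

lemma totally_dense_L_coll_Diff:
  fixes E :: "((real ^ 'm) \<times> (real ^ 'n)) set"
  assumes E: "E \<subseteq> T_space"
    and V: "subspace V1" "subspace V2" and H: "subspace H1" "subspace H2"
    and dim: "dim V1 + dim H1 > CARD('m)" "dim V2 + dim H2 > CARD('m)"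
    and C: "C1 = H1 \<times> (sphere 0 1 \<inter> V1)" "C2 = H2 \<times> (sphere 0 1 \<inter> V2)"
    and sub: "C1 \<subseteq> closure (C1 - C2)" "C2 \<subseteq> closure (C2 - C1)"
    and clo: "C1 \<union> C2 \<subseteq> closure E"
  shows "totally_dense (L_coll (E - C1 \<inter> C2))"
proof (rule totally_dense_L_coll[OF _ V H dim])
  have "closed C1" "closed C2" using C V H by (simp_all add: closed_Times_sphere_Int)
  then show "H1 \<times> (sphere 0 1 \<inter> V1) \<subseteq> closure (E - C1 \<inter> C2)"
    and "H2 \<times> (sphere 0 1 \<inter> V2) \<subseteq> closure (E - C1 \<inter> C2)"
    using subset_closure_Diff_Int[OF sub(1), of E] subset_closure_Diff_Int[OF sub(2), of E] clo
    by (simp_all add: C[symmetric] Int_commute[of C2])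
\<comment> \<open>Parameters in \<open>E\<close> have unit second component, so for them membership
  in \<open>V1\<close> or \<open>V2\<close> already means membership in the subsphere.\<close>
qed (use E C in \<open>auto simp: T_space_def\<close>)

section \<open>The three configurations of subspheres and subspaces\<close>

theorem theorem2p1:
  fixes E :: "((real ^ 'm) \<times> (real ^ 'n)) set" and k :: nat
  assumes "E \<subseteq> T_space"
    and "k \<le> min (CARD('n) - 1) CARD('m)"
    and "(\<exists>\<Phi>1 \<Phi>2 H. subsphere k \<Phi>1 \<and> subsphere k \<Phi>2 \<and> \<Phi>1 \<noteq> \<Phi>2 \<and>
            subspace H \<and> dim H = CARD('m) - k \<and>
            H \<times> (\<Phi>1 \<union> \<Phi>2) \<subseteq> T_closure E)
       \<or> (\<exists>\<Phi> H1 H2. subsphere k \<Phi> \<and>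
            subspace H1 \<and> dim H1 = CARD('m) - k \<and>
            subspace H2 \<and> dim H2 = CARD('m) - k \<and> H1 \<noteq> H2 \<and>
            (H1 \<union> H2) \<times> \<Phi> \<subseteq> T_closure E)
       \<or> (\<exists>\<Phi> H. subsphere k \<Phi> \<and>
            subspace H \<and> dim H = CARD('m) - k \<and>
            H \<times> \<Phi> \<subseteq> T_closure (E - H \<times> \<Phi>))"
  shows "\<exists>\<L>. \<L> \<subseteq> L_coll E \<and> totally_dense \<L>"
proof -
  \<comment> \<open>Since \<open>k\<close> is at most \<open>CARD('m)\<close>, the natural
    subtraction is exact and the sum is \<open>CARD('m) + 1\<close>, just enough for a nonzero
    vector.\<close>
  have dim: "dim V + dim H > CARD('m)"
    if "dim V = k + 1" "dim H = CARD('m) - k" for V :: "(real ^ 'n) set" and H :: "(real ^ 'm) set"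
    using that assms(2) by simp
  have mono: "L_coll (E - C) \<subseteq> L_coll E" for C
    by (auto simp: L_coll_def)
  from assms(3) show ?thesis
  proof (elim disjE exE conjE)
    fix \<Phi>1 \<Phi>2 :: "(real ^ 'n) set" and H :: "(real ^ 'm) set"
    assume "subsphere k \<Phi>1" "subsphere k \<Phi>2" "\<Phi>1 \<noteq> \<Phi>2" and H: "subspace H" "dim H = CARD('m) - k"
      and clo: "H \<times> (\<Phi>1 \<union> \<Phi>2) \<subseteq> T_closure E"
    then obtain V1 V2 where V: "subspace V1" "subspace V2" "dim V1 = k + 1" "dim V2 = k + 1"
      and \<Phi>: "\<Phi>1 = sphere 0 1 \<inter> V1" "\<Phi>2 = sphere 0 1 \<inter> V2" "V1 \<noteq> V2"
      unfolding subsphere_def by metis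
    \<comment> \<open>Distinct subspaces of equal dimension cannot be nested.\<close>
    have "\<not> V1 \<subseteq> V2" "\<not> V2 \<subseteq> V1"
      using V \<Phi>(3) subspace_dim_equal by (metis order_refl)+
    moreover have "\<Phi>1 - \<Phi>2 = \<Phi>1 - V2" "\<Phi>2 - \<Phi>1 = \<Phi>2 - V1"
      using \<Phi> by auto
    ultimately have d: "\<Phi>1 \<subseteq> closure (\<Phi>1 - \<Phi>2)" "\<Phi>2 \<subseteq> closure (\<Phi>2 - \<Phi>1)"
      using sphere_Int_subset_closure_Diff V \<Phi> by simp_all
    \<comment> \<open>The products share the factor \<open>H\<close>, so their difference is
      \<open>H\<close> times the difference of the subspheres, and closure commutes with
      products.\<close>
    have "H \<times> \<Phi>1 \<subseteq> closure (H \<times> \<Phi>1 - H \<times> \<Phi>2)" "H \<times> \<Phi>2 \<subseteq> closure (H \<times> \<Phi>2 - H \<times> \<Phi>1)"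
      using d closure_subset[of H] by (auto simp: closure_Times simp flip: Sigma_Diff_distrib2)
    then have "totally_dense (L_coll (E - H \<times> \<Phi>1 \<inter> H \<times> \<Phi>2))"
      using V H \<Phi> clo T_closure_subset_closure[of E]
      by (intro totally_dense_L_coll_Diff[where ?V1.0 = V1 and ?V2.0 = V2 and ?H1.0 = H and ?H2.0 = H]
          assms dim) auto
    then show ?thesis using mono by blast
  next
    fix \<Phi> :: "(real ^ 'n) set" and H1 H2 :: "(real ^ 'm) set"
    assume "subsphere k \<Phi>" and H: "subspace H1" "dim H1 = CARD('m) - k"
      "subspace H2" "dim H2 = CARD('m) - k" "H1 \<noteq> H2"
      and clo: "(H1 \<union> H2) \<times> \<Phi> \<subseteq> T_closure E"
    then obtain V where V: "subspace V" "dim V = k + 1" and \<Phi>: "\<Phi> = sphere 0 1 \<inter> V"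
      unfolding subsphere_def by metis
    have "\<not> H1 \<subseteq> H2" "\<not> H2 \<subseteq> H1"
      using H subspace_dim_equal by (metis order_refl)+
    then have d: "H1 \<subseteq> closure (H1 - H2)" "H2 \<subseteq> closure (H2 - H1)"
      using subspace_subset_closure_Diff H by blast+
    \<comment> \<open>Here the shared factor is \<open>\<Phi>\<close>, and the density of the
      difference comes from the linear factors.\<close>
    have "H1 \<times> \<Phi> \<subseteq> closure (H1 \<times> \<Phi> - H2 \<times> \<Phi>)" "H2 \<times> \<Phi> \<subseteq> closure (H2 \<times> \<Phi> - H1 \<times> \<Phi>)"
      using d closure_subset[of \<Phi>] by (auto simp: closure_Times simp flip: Times_Diff_distrib1)
    then have "totally_dense (L_coll (E - H1 \<times> \<Phi> \<inter> H2 \<times> \<Phi>))"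
      using V H \<Phi> clo T_closure_subset_closure[of E]
      by (intro totally_dense_L_coll_Diff[where ?V1.0 = V and ?V2.0 = V and ?H1.0 = H1 and ?H2.0 = H2]
          assms dim) auto
    then show ?thesis using mono by blast
  next
    fix \<Phi> :: "(real ^ 'n) set" and H :: "(real ^ 'm) set"
    assume "subsphere k \<Phi>" and H: "subspace H" "dim H = CARD('m) - k"
      and clo: "H \<times> \<Phi> \<subseteq> T_closure (E - H \<times> \<Phi>)"
    then obtain V where V: "subspace V" "dim V = k + 1" and \<Phi>: "\<Phi> = sphere 0 1 \<inter> V"
      unfolding subsphere_def by metis
    \<comment> \<open>Both products are taken to be \<open>H \<times> \<Phi>\<close>; their
      intersection is then the whole product, which the hypothesis allows to be deleted.\<close>
    have "totally_dense (L_coll (E - H \<times> \<Phi>))"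
      using V H \<Phi> clo T_closure_subset_closure[of "E - H \<times> \<Phi>"] assms(1)
      by (intro totally_dense_L_coll[where ?V1.0 = V and ?V2.0 = V and ?H1.0 = H and ?H2.0 = H] dim)
        (auto simp: T_space_def)
    then show ?thesis using mono by blast
  qed
qed

end
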